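(* Let $F$ be an algebraically closed field of characteristic zero and $R$ a Rota–Baxter operator of nonzero weight $\lambda$ on $M_n(F)$. Then there exists an automorphism $\psi$ of $M_n(F)$ such that the matrix $R^{(\psi)}(1)=\psi^{-1}R\psi(1)$ is diagonal and, after possibly replacing $R$ by $\phi(R)=-R-\lambda\,\mathrm{id}$, the set of its diagonal entries equals $\{-p\lambda,(-p+1)\lambda,\dots,-\lambda,0,\lambda,\dots,q\lambda\}$ for some nonnegative integers $p,q$.
   Context: A linear operator $R$ on an algebra $A$ is a Rota–Baxter operator of weight $\lambda$ if $R(x)R(y)=R(R(x)y+xR(y)+\lambda xy)$ for all $x,y\in A$. For $\psi\in\mathrm{Aut}(A)$, $R^{(\psi)}=\psi^{-1}R\psi$ is again an RB-operator of weight $\lambda$, and so is $\phi(R)=-R-\lambda\,\mathrm{id}$. *)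

theory Defs
  imports "HOL-Computational_Algebra.Polynomial" "Jordan_Normal_Form.Matrix"
begin

definition lin_op_mat :: "nat \<Rightarrow> ('a::field mat \<Rightarrow> 'a mat) \<Rightarrow> bool" where
  "lin_op_mat n R \<longleftrightarrow>
     (\<forall>A \<in> carrier_mat n n. R A \<in> carrier_mat n n) \<and>
     (\<forall>A \<in> carrier_mat n n. \<forall>B \<in> carrier_mat n n. R (A + B) = R A + R B) \<and>
     (\<forall>c. \<forall>A \<in> carrier_mat n n. R (c \<cdot>\<^sub>m A) = c \<cdot>\<^sub>m R A)"

definition rota_baxter_mat :: "nat \<Rightarrow> 'a::field \<Rightarrow> ('a mat \<Rightarrow> 'a mat) \<Rightarrow> bool" where
  "rota_baxter_mat n lam R \<longleftrightarrow> lin_op_mat n R \<and>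
     (\<forall>x \<in> carrier_mat n n. \<forall>y \<in> carrier_mat n n.
        R x * R y = R (R x * y + x * R y + lam \<cdot>\<^sub>m (x * y)))"

definition mat_alg_aut :: "nat \<Rightarrow> ('a::field mat \<Rightarrow> 'a mat) \<Rightarrow> bool" where
  "mat_alg_aut n \<psi> \<longleftrightarrow> bij_betw \<psi> (carrier_mat n n) (carrier_mat n n) \<and>
     (\<forall>A \<in> carrier_mat n n. \<forall>B \<in> carrier_mat n n. \<psi> (A + B) = \<psi> A + \<psi> B) \<and>
     (\<forall>A \<in> carrier_mat n n. \<forall>B \<in> carrier_mat n n. \<psi> (A * B) = \<psi> A * \<psi> B) \<and>
     (\<forall>c. \<forall>A \<in> carrier_mat n n. \<psi> (c \<cdot>\<^sub>m A) = c \<cdot>\<^sub>m \<psi> A) \<and>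
     \<psi> (1\<^sub>m n) = 1\<^sub>m n"

definition rb_conj :: "nat \<Rightarrow> ('a mat \<Rightarrow> 'a mat) \<Rightarrow> ('a mat \<Rightarrow> 'a mat) \<Rightarrow> 'a mat \<Rightarrow> 'a mat" where
  "rb_conj n \<psi> R = (\<lambda>A. the_inv_into (carrier_mat n n) \<psi> (R (\<psi> A)))"

definition rb_phi :: "'a::field \<Rightarrow> ('a mat \<Rightarrow> 'a mat) \<Rightarrow> 'a mat \<Rightarrow> 'a mat" where
  "rb_phi lam R = (\<lambda>A. - R A - lam \<cdot>\<^sub>m A)"

definition diag_entries :: "nat \<Rightarrow> 'a mat \<Rightarrow> 'a set" where
  "diag_entries n M = {M $$ (i, i) | i. i < n}"

end

theory Submission
  imports Defs "Jordan_Normal_Form.Determinant"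
begin

text \<open>
  Rescaling makes the weight 1; put \<open>A = R(1)\<close>. The Rota-Baxter identity with first argument 1
  shows that \<open>R\<close> maps \<open>f(A)\<close> to \<open>s(A)\<close>, where \<open>s\<close> is the indefinite sum of the polynomial \<open>f\<close>:
  \<open>s(x + 1) - s(x) = f(x)\<close> and \<open>s(0) = 0\<close>. For the minimal polynomial \<open>m\<close> of \<open>A\<close> this gives
  \<open>s = m g\<close> with \<open>g\<close> linear, so \<open>m(x + 1) g(x + 1) = m(x) (1 + g(x))\<close>. Hence a root \<open>r\<close> of \<open>m\<close> for
  which \<open>r + 1\<close> is not a root has \<open>r + 1\<close> equal to the root of \<open>g\<close>: the roots of \<open>m\<close> form a single
  progression with step 1, and differentiating the identity shows that they are simple, so \<open>A\<close> is
  diagonalizable. Finally \<open>m(0) g(0) = 0\<close> forces 0 or \<open>-1\<close> to be a root, and the passage to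
  \<open>-R - id\<close> exchanges these two values.
\<close>

section \<open>Polynomials evaluated at a square matrix\<close>

text \<open>Horner evaluation. The type of matrices does not record their size, so it is read off
  from \<open>A\<close>; the laws below assume \<open>A\<close> square.\<close>

definition mat_poly :: "'a::comm_ring_1 poly \<Rightarrow> 'a mat \<Rightarrow> 'a mat" where
  "mat_poly p A = fold_coeffs (\<lambda>c M. c \<cdot>\<^sub>m 1\<^sub>m (dim_row A) + A * M) p (0\<^sub>m (dim_row A) (dim_row A))"

lemma mat_poly_0: "A \<in> carrier_mat n n \<Longrightarrow> mat_poly 0 A = 0\<^sub>m n n"
  by (simp add: mat_poly_def)

lemma mat_poly_pCons:
  assumes "A \<in> carrier_mat n n"
  shows "mat_poly (pCons c p) A = c \<cdot>\<^sub>m 1\<^sub>m n + A * mat_poly p A"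
\<comment> \<open>\<open>fold_coeffs\<close> skips the zero coefficient of \<open>pCons 0 0\<close>,
  so the Horner step needs a separate check there.\<close>
proof (cases "c = 0 \<and> p = 0")
  case True
  have "(0::'a) \<cdot>\<^sub>m 1\<^sub>m n + A * 0\<^sub>m n n = 0\<^sub>m n n"
    using assms by (intro eq_matI) auto
  with True assms show ?thesis by (simp add: mat_poly_0)
next
  case False
  with assms show ?thesis by (auto simp: mat_poly_def)
qed

lemma mat_poly_carrier [simp]:
  "A \<in> carrier_mat n n \<Longrightarrow> mat_poly p A \<in> carrier_mat n n"
  by (induction p) (auto simp: mat_poly_0 mat_poly_pCons)

lemma mat_poly_1: "A \<in> carrier_mat n n \<Longrightarrow> mat_poly 1 A = 1\<^sub>m n"
  unfolding one_pCons by (auto simp: mat_poly_pCons mat_poly_0 intro!: eq_matI)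

lemma mat_poly_X: "A \<in> carrier_mat n n \<Longrightarrow> mat_poly [:0, 1:] A = A"
  using mat_poly_1[of A n] by (auto simp: mat_poly_pCons mat_poly_0 intro!: eq_matI)

lemma mat_poly_add:
  assumes A: "A \<in> carrier_mat n n"
  shows "mat_poly (p + q) A = mat_poly p A + mat_poly q A"
proof (induction p q rule: poly_induct2)
  case 0
  show ?case using A by (simp add: mat_poly_0)
next
  case (pCons a p b q)
  have "mat_poly (pCons a p + pCons b q) A
      = (a + b) \<cdot>\<^sub>m 1\<^sub>m n + (A * mat_poly p A + A * mat_poly q A)"
    using A mult_add_distrib_mat[OF A mat_poly_carrier[OF A] mat_poly_carrier[OF A]]
    by (simp add: mat_poly_pCons pCons)
  also have "\<dots> = (a \<cdot>\<^sub>m 1\<^sub>m n + A * mat_poly p A) + (b \<cdot>\<^sub>m 1\<^sub>m n + A * mat_poly q A)"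
    using A mat_poly_carrier[OF A, of p] mat_poly_carrier[OF A, of q]
    by (intro eq_matI) (auto simp: algebra_simps carrier_matD[OF mat_poly_carrier[OF A]]
      simp del: index_mult_mat(1))
  finally show ?case using A by (simp add: mat_poly_pCons)
qed

lemma mat_poly_smult:
  assumes A: "A \<in> carrier_mat n n"
  shows "mat_poly (Polynomial.smult c p) A = c \<cdot>\<^sub>m mat_poly p A"
proof (induction p)
  case 0
  show ?case using A by (simp add: mat_poly_0)
next
  case (pCons a p)
  have "A * (c \<cdot>\<^sub>m mat_poly p A) = c \<cdot>\<^sub>m (A * mat_poly p A)"
    using A by (intro mult_smult_distrib[of _ n n _ n]) auto
  thus ?case using A mat_poly_carrier[OF A, of p]
    by (simp add: mat_poly_pCons pCons)
       (intro eq_matI, auto simp: algebra_simps carrier_matD[OF mat_poly_carrier[OF A]]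
          simp del: index_mult_mat(1))
qed

lemma mat_poly_mult:
  assumes A: "A \<in> carrier_mat n n"
  shows "mat_poly (p * q) A = mat_poly p A * mat_poly q A"
proof (induction p)
  case 0
  show ?case using A left_mult_zero_mat[OF mat_poly_carrier[OF A, of q]] by (simp add: mat_poly_0)
next
  case (pCons a p)
  note C = mat_poly_carrier[OF A]
  have "mat_poly (pCons a p * q) A = a \<cdot>\<^sub>m mat_poly q A + mat_poly (pCons 0 (p * q)) A"
    using A by (simp add: mat_poly_add mat_poly_smult)
  also have "mat_poly (pCons 0 (p * q)) A = A * (mat_poly p A * mat_poly q A)"
    using A C[of p] C[of q] mult_carrier_mat[OF A mult_carrier_mat[OF C[of p] C[of q]]]
    by (simp add: mat_poly_pCons pCons) (intro eq_matI, auto simp del: index_mult_mat(1))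
  also have "\<dots> = (A * mat_poly p A) * mat_poly q A"
    by (rule assoc_mult_mat[OF A C C, symmetric])
  also have "a \<cdot>\<^sub>m mat_poly q A = (a \<cdot>\<^sub>m 1\<^sub>m n) * mat_poly q A"
    using mult_smult_assoc_mat[OF one_carrier_mat C[of q]] C[of q] by simp
  also have "(a \<cdot>\<^sub>m 1\<^sub>m n) * mat_poly q A + (A * mat_poly p A) * mat_poly q A
      = (a \<cdot>\<^sub>m 1\<^sub>m n + A * mat_poly p A) * mat_poly q A"
    using A C[of p] C[of q] by (intro add_mult_distrib_mat[symmetric, of _ n n _ _ n]) auto
  finally show ?case using A by (simp add: mat_poly_pCons)
qed

lemma mat_poly_0_vec:
  assumes "A \<in> carrier_mat n n" "v \<in> carrier_vec n"
  shows "mat_poly 0 A *\<^sub>v v = 0\<^sub>v n"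
  using assms by (intro eq_vecI) (auto simp: mat_poly_0)

lemma mat_poly_pCons_vec:
  assumes A: "A \<in> carrier_mat n n" and v: "v \<in> carrier_vec n"
  shows "mat_poly (pCons a p) A *\<^sub>v v = a \<cdot>\<^sub>v v + A *\<^sub>v (mat_poly p A *\<^sub>v v)"
proof -
  note C = mat_poly_carrier[OF A]
  have "(a \<cdot>\<^sub>m 1\<^sub>m n + A * mat_poly p A) *\<^sub>v v = (a \<cdot>\<^sub>m 1\<^sub>m n) *\<^sub>v v + (A * mat_poly p A) *\<^sub>v v"
    using A C[of p] v by (intro add_mult_distrib_mat_vec[of _ n n]) auto
  also have "(A * mat_poly p A) *\<^sub>v v = A *\<^sub>v (mat_poly p A *\<^sub>v v)"
    by (rule assoc_mult_mat_vec[OF A C v])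
  also have "(a \<cdot>\<^sub>m 1\<^sub>m n) *\<^sub>v v = a \<cdot>\<^sub>v v"
    using v by (intro eq_vecI) (auto simp: scalar_prod_def if_distrib if_distribR cong: if_cong)
  finally show ?thesis using A by (simp add: mat_poly_pCons)
qed

lemma mat_poly_eigenvector:
  fixes A :: "'a::field mat"
  assumes A: "A \<in> carrier_mat n n" and v: "v \<in> carrier_vec n" and ev: "A *\<^sub>v v = e \<cdot>\<^sub>v v"
  shows "mat_poly p A *\<^sub>v v = poly p e \<cdot>\<^sub>v v"
proof (induction p)
  case 0
  show ?case using A v by (simp add: mat_poly_0_vec) (intro eq_vecI, auto)
next
  case (pCons a p)
  have "A *\<^sub>v (mat_poly p A *\<^sub>v v) = poly p e \<cdot>\<^sub>v (e \<cdot>\<^sub>v v)"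
    using A v by (simp add: pCons mult_mat_vec[of A n n] ev)
  thus ?case using A v
    by (simp add: mat_poly_pCons_vec) (intro eq_vecI, auto simp: algebra_simps)
qed

section \<open>Existence of a minimal polynomial\<close>

text \<open>The n^2 + 1 powers of \<open>A\<close> with exponents up to n^2 lie in a space of
  dimension n^2 and are therefore dependent. They are flattened into the columns of
  \<open>M\<close>; the zero row makes \<open>M\<close> square, so that a vanishing determinant
  gives a kernel vector.\<close>

lemma annihilating_poly_exists:
  fixes A :: "'a::field mat"
  assumes A: "A \<in> carrier_mat n n"
  shows "\<exists>p. p \<noteq> 0 \<and> mat_poly p A = 0\<^sub>m n n"
proof -
  define N where "N = n * n"
  define M where "M = mat (Suc N) (Suc N)
    (\<lambda>(i, k). if i < N then mat_poly (monom 1 k) A $$ (i div n, i mod n) else 0)"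
  have M: "M \<in> carrier_mat (Suc N) (Suc N)" by (simp add: M_def)
  \<comment> \<open>The last row of \<open>M\<close> vanishes, and a kernel vector lists the coefficients of the polynomial.\<close>
  have "det M = 0"
  proof -
    have "det M = (\<Sum>k<Suc N. M $$ (N, k) * cofactor M N k)"
      by (rule laplace_expansion_row[OF M]) simp
    also have "\<dots> = 0" by (intro sum.neutral) (auto simp: M_def)
    finally show ?thesis .
  qed
  then obtain v where v: "v \<in> carrier_vec (Suc N)" "v \<noteq> 0\<^sub>v (Suc N)" "M *\<^sub>v v = 0\<^sub>v (Suc N)"
    using det_0_iff_vec_prod_zero_field[OF M] by blast
  define p where "p = (\<Sum>k<Suc N. Polynomial.smult (v $ k) (monom 1 k))"
  have coeff: "coeff p i = v $ i" if "i < Suc N" for i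
  proof -
    have "coeff p i = (\<Sum>k<Suc N. if k = i then v $ i else 0)"
      unfolding p_def coeff_sum by (intro sum.cong) auto
    thus ?thesis using that by simp
  qed
  have "p \<noteq> 0"
  proof
    assume "p = 0"
    hence "v = 0\<^sub>v (Suc N)" using coeff v(1) by (intro eq_vecI) auto
    with v(2) show False by simp
  qed
  moreover have entry: "mat_poly (\<Sum>k<K. Polynomial.smult (v $ k) (monom 1 k)) A $$ (i, j)
      = (\<Sum>k<K. mat_poly (monom 1 k) A $$ (i, j) * v $ k)" if "i < n" "j < n" for i j K
    using that A carrier_matD[OF mat_poly_carrier[OF A]]
    by (induction K) (auto simp: mat_poly_0 mat_poly_add mat_poly_smult)
  have "mat_poly p A = 0\<^sub>m n n"
  proof (rule eq_matI)
    fix i j assume "i < dim_row (0\<^sub>m n n)" "j < dim_col (0\<^sub>m n n)"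
    hence ij: "i < n" "j < n" by auto
    \<comment> \<open>\<open>i * n + j\<close> is the row of \<open>M\<close> holding the entries at
      \<open>(i, j)\<close>; the bound keeps it off the zero row.\<close>
    have "i * n + j < N"
    proof -
      have "i * n + j < Suc i * n" using ij by simp
      also have "\<dots> \<le> n * n" using ij by (intro mult_right_mono) auto
      finally show ?thesis by (simp add: N_def)
    qed
    hence "0 = (M *\<^sub>v v) $ (i * n + j)" by (simp add: v(3))
    also have "\<dots> = (\<Sum>k<Suc N. mat_poly (monom 1 k) A $$ (i, j) * v $ k)"
      using \<open>i * n + j < N\<close> v(1) ij
      by (auto simp: M_def scalar_prod_def atLeast0LessThan intro!: sum.cong)
    also have "\<dots> = mat_poly p A $$ (i, j)" using ij by (simp only: entry p_def)
    finally show "mat_poly p A $$ (i, j) = 0\<^sub>m n n $$ (i, j)" using ij by simp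
  qed (use carrier_matD[OF mat_poly_carrier[OF A]] in auto)
  ultimately show ?thesis by blast
qed

text \<open>A nonzero annihilating polynomial of least degree generates the annihilating ideal, by
  division with remainder. It is not made monic, since scaling changes neither divisibility nor
  roots.\<close>

lemma minimal_poly_exists:
  fixes A :: "'a::field mat"
  assumes A: "A \<in> carrier_mat n n"
  obtains m where "m \<noteq> 0" "\<And>p. mat_poly p A = 0\<^sub>m n n \<longleftrightarrow> m dvd p"
proof -
  define P where "P p \<longleftrightarrow> p \<noteq> 0 \<and> mat_poly p A = 0\<^sub>m n n" for p
  have "\<exists>p. P p" using annihilating_poly_exists[OF A] by (simp add: P_def)
  then obtain m where m: "P m" and min: "\<And>p. P p \<Longrightarrow> degree m \<le> degree p"
    using ex_has_least_nat[of P _ degree] by blast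
  have mult: "mat_poly (m * q) A = 0\<^sub>m n n" for q
    using m left_mult_zero_mat[OF mat_poly_carrier[OF A]] by (simp add: mat_poly_mult[OF A] P_def)
  show ?thesis
  proof (rule that[of m])
    show "m \<noteq> 0" using m by (simp add: P_def)
    show "mat_poly p A = 0\<^sub>m n n \<longleftrightarrow> m dvd p" for p
    proof
      assume p: "mat_poly p A = 0\<^sub>m n n"
      have "p mod m = p + m * - (p div m)"
        by (simp add: minus_mult_div_eq_mod[symmetric])
      hence "mat_poly (p mod m) A = 0\<^sub>m n n"
        using mult p by (simp only: mat_poly_add[OF A]) simp
      hence "p mod m = 0"
        using min[of "p mod m"] degree_mod_less[OF \<open>m \<noteq> 0\<close>, of p] by (force simp: P_def)
      thus "m dvd p" by auto
    next
      assume "m dvd p"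
      thus "mat_poly p A = 0\<^sub>m n n" using mult by (auto elim!: dvdE)
    qed
  qed
qed

section \<open>Diagonalization from simple roots\<close>

text \<open>Dual form of the statement that the kernel of \<open>m(A)\<close> is spanned by eigenvectors.\<close>

lemma annihilates_eigenvectors_imp_annihilates_kernel:
  fixes A :: "'a::alg_closed_field mat"
  assumes A: "A \<in> carrier_mat n n" and u: "u \<in> carrier_vec n"
    and eig: "\<And>w e. w \<in> carrier_vec n \<Longrightarrow> A *\<^sub>v w = e \<cdot>\<^sub>v w \<Longrightarrow> u \<bullet> w = 0"
    and "m \<noteq> 0" "\<And>r. poly m r = 0 \<Longrightarrow> poly (pderiv m) r \<noteq> 0"
    and "v \<in> carrier_vec n" "mat_poly m A *\<^sub>v v = 0\<^sub>v n"
  shows "u \<bullet> v = 0"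
  using assms(4-)
proof (induction "degree m" arbitrary: m v)
  case 0
  then obtain c where c: "m = [:c:]" "c \<noteq> 0" by (metis degree_eq_zeroE pCons_0_0)
  have "mat_poly m A *\<^sub>v v = c \<cdot>\<^sub>v v" 
    using A 0(4) by (auto simp: c(1) mat_poly_pCons_vec mat_poly_0_vec intro!: eq_vecI)
  hence "(c \<cdot>\<^sub>v v) $ i = 0" if "i < n" for i using 0(5) that by (metis index_zero_vec(1))
  hence "v = 0\<^sub>v n" using 0(4) c(2) by (intro eq_vecI) auto
  thus ?case using u by simp
next
  case (Suc d)
  note C = mat_poly_carrier[OF A] and v = Suc.prems(3)
  obtain r where r: "poly m r = 0" using alg_closed_imp_poly_has_root[of m] Suc.hyps(2) by auto
  then obtain f where f: "m = [:- r, 1:] * f" by (metis dvdE poly_eq_0_iff_dvd)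
  have f0: "f \<noteq> 0" using Suc.prems(1) f by auto
  have deg: "d = degree f" using Suc.hyps(2) f0 unfolding f by (subst (asm) degree_mult_eq) auto
  have pd: "poly (pderiv m) x = poly f x + (x - r) * poly (pderiv f) x" for x
    unfolding f pderiv_mult by (simp add: pderiv_pCons algebra_simps)
  \<comment> \<open>Simplicity of the root enters here: \<open>pd\<close> at \<open>r\<close> says
    that m'(r) = f(r).\<close>
  have fr: "poly f r \<noteq> 0" using Suc.prems(2)[OF r] pd[of r] by simp
  have simple: "poly (pderiv f) s \<noteq> 0" if "poly f s = 0" for s
    using Suc.prems(2)[of s] pd[of s] that by (auto simp: f)
  \<comment> \<open>As (A - r) f(A) v = m(A) v = 0, the vector \<open>w\<close> satisfies A w = r w
    and is killed by \<open>u\<close>.\<close>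
  define w where "w = mat_poly f A *\<^sub>v v"
  have w: "w \<in> carrier_vec n" using C[of f] v by (simp add: w_def)
  have "A *\<^sub>v w = r \<cdot>\<^sub>v w"
  proof (rule eq_vecI)
    fix i assume i: "i < dim_vec (r \<cdot>\<^sub>v w)"
    have "mat_poly [:- r, 1:] A *\<^sub>v w = 0\<^sub>v n"
      using Suc.prems(4) assoc_mult_mat_vec[OF C C v, of "[:- r, 1:]" f]
      unfolding f mat_poly_mult[OF A] w_def by simp
    moreover have "A *\<^sub>v 0\<^sub>v n = 0\<^sub>v n" using A by (intro eq_vecI) auto
    ultimately have "- r \<cdot>\<^sub>v w + A *\<^sub>v w = 0\<^sub>v n"
      using A w by (simp add: mat_poly_pCons_vec mat_poly_0_vec)
    hence "(- r \<cdot>\<^sub>v w + A *\<^sub>v w) $ i = 0" using w i by (simp only:) simp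
    thus "(A *\<^sub>v w) $ i = (r \<cdot>\<^sub>v w) $ i" using A w i by simp
  qed (use A w in auto)
  hence uw: "u \<bullet> w = 0" using eig[OF w] by blast
  define c where "c = inverse (poly f r)"
  \<comment> \<open>Subtracting \<open>c\<close> times \<open>w\<close> removes the component for
    \<open>r\<close>: 1 - c f vanishes at \<open>r\<close>, so f (1 - c f) is a multiple of
    \<open>m\<close> and f(A) v' = 0. The induction hypothesis for \<open>f\<close> then applies to
    \<open>v'\<close>.\<close>
  define v' where "v' = v - c \<cdot>\<^sub>v w"
  have v': "v' \<in> carrier_vec n" using v w by (simp add: v'_def)
  have "poly (1 - Polynomial.smult c f) r = 0" using fr by (simp add: c_def)
  then obtain h where h: "1 - Polynomial.smult c f = [:- r, 1:] * h" by (metis dvdE poly_eq_0_iff_dvd)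
  have "mat_poly f A *\<^sub>v v' = 0\<^sub>v n"
  proof -
    have "v' = mat_poly (1 + Polynomial.smult (- c) f) A *\<^sub>v v"
      using v w C[of f] unfolding mat_poly_add[OF A] mat_poly_smult[OF A] mat_poly_1[OF A]
      by (subst add_mult_distrib_mat_vec[of _ n n]) (auto simp: v'_def w_def intro!: eq_vecI)
    hence "mat_poly f A *\<^sub>v v' = mat_poly (f * (1 - Polynomial.smult c f)) A *\<^sub>v v"
      by (simp add: mat_poly_mult[OF A] assoc_mult_mat_vec[OF C C v])
    also have "f * (1 - Polynomial.smult c f) = h * m" by (simp only: h f mult_ac)
    also have "mat_poly (h * m) A *\<^sub>v v = 0\<^sub>v n"
      using Suc.prems(4) C[of h] unfolding mat_poly_mult[OF A] assoc_mult_mat_vec[OF C C v]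
      by (intro eq_vecI) auto
    finally show ?thesis .
  qed
  hence "u \<bullet> v' = 0" using Suc.hyps(1)[OF deg f0 simple v'] by blast
  moreover have "u \<bullet> v' = u \<bullet> v - c * (u \<bullet> w)"
    using u v w by (simp add: v'_def scalar_prod_minus_distrib)
  ultimately show ?case using uw by simp
qed

text \<open>
  Steinitz exchange: replacing column \<open>k\<close> of \<open>P\<close> by \<open>w\<close> multiplies the determinant by entry \<open>k\<close> of
  \<open>P\<^sup>-\<^sup>1 w\<close>, and the hypothesis \<open>sep\<close> supplies an eigenvector for which it does not vanish.
\<close>

lemma eigenbasis_exchange:
  fixes A :: "'a::field mat"
  assumes A: "A \<in> carrier_mat n n"
    and sep: "\<And>u v. u \<in> carrier_vec n \<Longrightarrow> v \<in> carrier_vec n \<Longrightarrow> u \<bullet> v \<noteq> 0 \<Longrightarrow>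
      \<exists>w e. w \<in> carrier_vec n \<and> A *\<^sub>v w = e \<cdot>\<^sub>v w \<and> u \<bullet> w \<noteq> 0"
    and "k \<le> n"
  shows "\<exists>P \<in> carrier_mat n n. det P \<noteq> 0 \<and> (\<forall>j<k. \<exists>e. A *\<^sub>v col P j = e \<cdot>\<^sub>v col P j)"
  using \<open>k \<le> n\<close>
proof (induction k)
  case 0
  show ?case by (intro bexI[of _ "1\<^sub>m n"]) auto
next
  case (Suc k)
  then obtain P where P: "P \<in> carrier_mat n n" "det P \<noteq> 0"
    and eig: "\<And>j. j < k \<Longrightarrow> \<exists>e. A *\<^sub>v col P j = e \<cdot>\<^sub>v col P j" by auto
  have k: "k < n" using Suc.prems by simp
  obtain Q where Q: "Q \<in> carrier_mat n n" "P * Q = 1\<^sub>m n" "Q * P = 1\<^sub>m n"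
    using det_non_zero_imp_unit[OF P, of "()"] by (auto simp: Units_def ring_mat_simps)
  \<comment> \<open>Row \<open>k\<close> of \<open>Q\<close> reads off coordinate \<open>k\<close>
    with respect to the columns of \<open>P\<close>. It is 1 on column \<open>k\<close>, so
    \<open>sep\<close> applies to it.\<close>
  have "row Q k \<bullet> col P k = (Q * P) $$ (k, k)" using P Q(1) k by simp
  also have "\<dots> = 1" using k by (simp add: Q(3))
  finally have "row Q k \<bullet> col P k \<noteq> 0" by simp
  then obtain w e where w: "w \<in> carrier_vec n" "A *\<^sub>v w = e \<cdot>\<^sub>v w" "row Q k \<bullet> w \<noteq> 0"
    using sep[of "row Q k" "col P k"] P(1) Q(1) k by (metis col_dim carrier_matD row_carrier)
  define P' where "P' = replace_col P w k"
  have P': "P' \<in> carrier_mat n n" using P(1) by (auto simp: P'_def replace_col_def)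
  have Pw: "P *\<^sub>v (Q *\<^sub>v w) = w"
    using assoc_mult_mat_vec[OF P(1) Q(1) w(1)] w(1) by (simp add: Q(2))
  have "det P' = (Q *\<^sub>v w) $ k * det P"
    using cramer_lemma_mat[OF P(1) mult_mat_vec_carrier[OF Q(1) w(1)] k] by (simp add: P'_def Pw)
  hence "det P' \<noteq> 0" using w P Q k by simp
  moreover have "\<exists>e. A *\<^sub>v col P' j = e \<cdot>\<^sub>v col P' j" if "j < Suc k" for j
  proof (cases "j = k")
    case True
    have "col P' k = w" using P(1) w(1) k by (intro eq_vecI) (auto simp: P'_def replace_col_def)
    thus ?thesis using w(2) True by auto
  next
    case False
    have "col P' j = col P j" using P(1) k that False
      by (intro eq_vecI) (auto simp: P'_def replace_col_def)
    thus ?thesis using eig[of j] False that by auto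
  qed
  ultimately show ?case using P' by blast
qed

text \<open>As m(A) = 0, its kernel is the whole space, so a functional vanishing on all
  eigenvectors is zero. The contrapositive is the hypothesis \<open>sep\<close> of the exchange
  lemma, and exchanging all \<open>n\<close> columns yields an invertible \<open>P\<close> of
  eigenvectors.\<close>

lemma diagonalizable_if_simple_roots:
  fixes A :: "'a::alg_closed_field mat"
  assumes A: "A \<in> carrier_mat n n"
    and m: "m \<noteq> 0" "mat_poly m A = 0\<^sub>m n n" "\<And>r. poly m r = 0 \<Longrightarrow> poly (pderiv m) r \<noteq> 0"
  obtains P Q D where "similar_mat_wit A D P Q" "diagonal_mat D"
proof -
  have sep: "\<exists>w e. w \<in> carrier_vec n \<and> A *\<^sub>v w = e \<cdot>\<^sub>v w \<and> u \<bullet> w \<noteq> 0"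
    if "u \<in> carrier_vec n" "v \<in> carrier_vec n" "u \<bullet> v \<noteq> 0" for u v
    using annihilates_eigenvectors_imp_annihilates_kernel[OF A that(1) _ m(1,3) that(2)] that m(2)
      mat_poly_0_vec[OF A] mat_poly_0[OF A] by metis
  obtain P where P: "P \<in> carrier_mat n n" "det P \<noteq> 0"
    and "\<forall>j<n. \<exists>e. A *\<^sub>v col P j = e \<cdot>\<^sub>v col P j"
    using eigenbasis_exchange[OF A _ order.refl] sep by blast
  then obtain e where e: "\<And>j. j < n \<Longrightarrow> A *\<^sub>v col P j = e j \<cdot>\<^sub>v col P j" by metis
  define D where "D = mat n n (\<lambda>(i, j). if i = j then e j else 0)"
  obtain Q where Q: "Q \<in> carrier_mat n n" "P * Q = 1\<^sub>m n" "Q * P = 1\<^sub>m n"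
    using det_non_zero_imp_unit[OF P, of "()"] by (auto simp: Units_def ring_mat_simps)
  have D: "D \<in> carrier_mat n n" by (simp add: D_def)
  have "A * P = P * D"
  proof (rule eq_matI)
    fix i j assume "i < dim_row (P * D)" "j < dim_col (P * D)"
    hence ij: "i < n" "j < n" using P D by auto
    have "(A * P) $$ (i, j) = (A *\<^sub>v col P j) $ i" using ij A P by simp
    also have "\<dots> = e j * P $$ (i, j)" using ij P by (simp add: e)
    also have "\<dots> = (\<Sum>k<n. if k = j then P $$ (i, k) * e j else 0)" using ij by simp
    also have "\<dots> = (P * D) $$ (i, j)" using ij P(1)
      by (auto simp: D_def scalar_prod_def atLeast0LessThan if_distrib intro!: sum.cong cong: if_cong)
    finally show "(A * P) $$ (i, j) = (P * D) $$ (i, j)" .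
  qed (use A P D in auto)
  hence "A = P * D * Q" using assoc_mult_mat[OF A P(1) Q(1)] A by (simp add: Q(2))
  hence "similar_mat_wit A D P Q" using A P(1) D Q by (auto simp: similar_mat_wit_def Let_def)
  moreover have "diagonal_mat D" by (simp add: diagonal_mat_def D_def)
  ultimately show ?thesis using that by blast
qed

text \<open>Every diagonal entry is an eigenvalue, with a column of \<open>P\<close> as eigenvector,
  hence a root of \<open>m\<close>. Conversely, if a root \<open>r\<close> were missing from the
  diagonal, m / (X - r) would still kill every column of \<open>P\<close>; it would annihilate
  \<open>A\<close> and be a multiple of \<open>m\<close> of smaller degree.\<close>

lemma diag_entries_eq_roots:
  fixes A :: "'a::field mat"
  assumes A: "A \<in> carrier_mat n n" and sim: "similar_mat_wit A D P Q" and diag: "diagonal_mat D"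
    and m: "m \<noteq> 0" "\<And>p. mat_poly p A = 0\<^sub>m n n \<longleftrightarrow> m dvd p"
  shows "diag_entries n D = {r. poly m r = 0}"
proof -
  have D: "D \<in> carrier_mat n n" and P: "P \<in> carrier_mat n n" and Q: "Q \<in> carrier_mat n n"
    and PQ: "P * Q = 1\<^sub>m n" and QP: "Q * P = 1\<^sub>m n" and APDQ: "A = P * D * Q"
    using similar_mat_witD2[OF A sim] by auto
  have "A * P = P * D"
    using APDQ assoc_mult_mat[of "P * D" n n Q n P n] P D Q QP by simp
  have ev: "A *\<^sub>v col P j = D $$ (j, j) \<cdot>\<^sub>v col P j" if j: "j < n" for j
  proof (rule eq_vecI)
    fix i assume "i < dim_vec (D $$ (j, j) \<cdot>\<^sub>v col P j)"
    hence i: "i < n" using P by simp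
    have "(A *\<^sub>v col P j) $ i = (A * P) $$ (i, j)" using i j A P by simp
    also have "\<dots> = (\<Sum>k<n. P $$ (i, k) * D $$ (k, j))" using i j P D
      by (auto simp: \<open>A * P = P * D\<close> scalar_prod_def atLeast0LessThan intro!: sum.cong)
    also have "\<dots> = (\<Sum>k<n. if k = j then P $$ (i, k) * D $$ (j, j) else 0)"
      using diag D j by (intro sum.cong) (auto simp: diagonal_mat_def)
    also have "\<dots> = (D $$ (j, j) \<cdot>\<^sub>v col P j) $ i" using i j P by simp
    finally show "(A *\<^sub>v col P j) $ i = (D $$ (j, j) \<cdot>\<^sub>v col P j) $ i" .
  qed (use A P in auto)
  have colP: "col P j \<in> carrier_vec n" for j using P by auto
  have pev: "mat_poly p A *\<^sub>v col P j = poly p (D $$ (j, j)) \<cdot>\<^sub>v col P j" if "j < n" for j p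
    using mat_poly_eigenvector[OF A colP ev] that by blast
  have "poly m (D $$ (j, j)) = 0" if j: "j < n" for j
  proof (rule ccontr)
    assume nz: "poly m (D $$ (j, j)) \<noteq> 0"
    have "0\<^sub>v n = poly m (D $$ (j, j)) \<cdot>\<^sub>v col P j"
      using pev[OF j, of m] m(2)[of m] mat_poly_0_vec[OF A colP[of j]] mat_poly_0[OF A] by simp
    hence "P $$ (i, j) = 0" if "i < n" for i
      using nz that j P by (auto dest!: arg_cong[of _ _ "\<lambda>v. v $ i"])
    hence "row Q j \<bullet> col P j = 0" using P Q j by (auto simp: scalar_prod_def intro!: sum.neutral)
    moreover have "row Q j \<bullet> col P j = (Q * P) $$ (j, j)" using P Q j by simp
    ultimately show False using j by (simp add: QP)
  qed
  moreover have "\<exists>j<n. D $$ (j, j) = r" if r: "poly m r = 0" for r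
  proof (rule ccontr)
    assume *: "\<not> ?thesis"
    obtain f where f: "m = [:- r, 1:] * f" using r by (metis dvdE poly_eq_0_iff_dvd)
    have "f \<noteq> 0" using m(1) f by auto
    have "poly f (D $$ (j, j)) = 0" if "j < n" for j
      using calculation[OF that] * that by (auto simp: f)
    hence "mat_poly f A *\<^sub>v col P j = 0\<^sub>v n" if "j < n" for j
      using pev[OF that, of f] that P by (simp, intro eq_vecI) auto
    hence "mat_poly f A * P = 0\<^sub>m n n"
      using mat_poly_carrier[OF A, of f] P
      by (intro eq_matI) (auto simp flip: index_mult_mat_vec)
    hence "mat_poly f A = 0\<^sub>m n n"
      using assoc_mult_mat[OF mat_poly_carrier[OF A, of f] P Q] mat_poly_carrier[OF A, of f] Q
      by (simp add: PQ)
    hence "m dvd f" using m(2) by blast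
    hence "degree m \<le> degree f" using \<open>f \<noteq> 0\<close> by (intro dvd_imp_degree_le)
    thus False using \<open>f \<noteq> 0\<close> unfolding f by (subst (asm) degree_mult_eq) auto
  qed
  ultimately show ?thesis unfolding diag_entries_def by blast
qed

section \<open>Falling factorials and the difference operator\<close>

text \<open>The falling factorial X (X - 1) ... (X - k + 1). On this basis the forward difference
  acts as the derivative does on powers, so indefinite sums are computed term by term.\<close>

definition ffact_poly :: "nat \<Rightarrow> 'a::comm_ring_1 poly" where
  "ffact_poly k = (\<Prod>i<k. [:- of_nat i, 1:])"

lemma ffact_poly_0 [simp]: "ffact_poly 0 = 1"
  by (simp add: ffact_poly_def)

lemma ffact_poly_Suc: "ffact_poly (Suc k) = [:- of_nat k, 1:] * ffact_poly k"
  by (simp add: ffact_poly_def)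

lemma X_times_ffact_poly:
  "[:0, 1:] * ffact_poly k = ffact_poly (Suc k) + Polynomial.smult (of_nat k) (ffact_poly k)"
  by (simp add: ffact_poly_Suc)

lemma degree_ffact_poly [simp]: "degree (ffact_poly k :: 'a::idom poly) = k"
  unfolding ffact_poly_def by (subst degree_prod_eq_sum_degree) auto

lemma lead_coeff_ffact_poly: "Polynomial.coeff (ffact_poly k :: 'a::idom poly) k = 1"
proof -
  have "lead_coeff (ffact_poly k :: 'a poly) = 1"
    unfolding ffact_poly_def by (subst lead_coeff_prod) auto
  thus ?thesis by simp
qed

lemma poly_ffact_poly_Suc_0: "poly (ffact_poly (Suc k)) 0 = 0"
  by (simp add: ffact_poly_def poly_prod prod.lessThan_Suc_shift del: prod.lessThan_Suc)

lemma ffact_poly_difference: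
  "poly (ffact_poly (Suc k)) (x + 1) - poly (ffact_poly (Suc k)) x
     = of_nat (Suc k) * poly (ffact_poly k) x"
proof -
  \<comment> \<open>With the factor for \<open>i = 0\<close> split off, the shift by 1 turns the
    remaining factors into those of \<open>ffact_poly k\<close>.\<close>
  have "poly (ffact_poly (Suc k)) (x + 1) = (x + 1) * poly (ffact_poly k) x"
    by (simp add: ffact_poly_def poly_prod prod.lessThan_Suc_shift algebra_simps
             del: prod.lessThan_Suc)
  thus ?thesis by (simp add: ffact_poly_Suc algebra_simps)
qed


section \<open>Action of a weight 1 operator on polynomials in T(1)\<close>

locale unit_weight_rota_baxter =
  fixes n :: nat and T :: "'a::field_char_0 mat \<Rightarrow> 'a mat" and A :: "'a mat"
  assumes rb: "rota_baxter_mat n 1 T" and A_def: "A = T (1\<^sub>m n)"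
begin

lemma T_carrier: "X \<in> carrier_mat n n \<Longrightarrow> T X \<in> carrier_mat n n"
  and T_add: "X \<in> carrier_mat n n \<Longrightarrow> Y \<in> carrier_mat n n \<Longrightarrow> T (X + Y) = T X + T Y"
  and T_smult: "X \<in> carrier_mat n n \<Longrightarrow> T (c \<cdot>\<^sub>m X) = c \<cdot>\<^sub>m T X"
  using rb by (auto simp: rota_baxter_mat_def lin_op_mat_def)

lemma A_carrier: "A \<in> carrier_mat n n"
  by (simp add: A_def T_carrier)

text \<open>A relation and not a map on polynomials, because \<open>f\<close> and \<open>s\<close>
  matter only modulo the minimal polynomial of \<open>A\<close>.\<close>

definition represents :: "'a poly \<Rightarrow> 'a poly \<Rightarrow> bool" where
  "represents f s \<longleftrightarrow> T (mat_poly f A) = mat_poly s A"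

lemma represents_add: "represents f s \<Longrightarrow> represents g t \<Longrightarrow> represents (f + g) (s + t)"
  by (simp add: represents_def mat_poly_add[OF A_carrier] T_add A_carrier)

lemma represents_smult: "represents f s \<Longrightarrow> represents (Polynomial.smult c f) (Polynomial.smult c s)"
  by (simp add: represents_def mat_poly_smult[OF A_carrier] T_smult A_carrier)

lemma represents_1: "represents 1 [:0, 1:]"
  using A_carrier by (simp add: represents_def mat_poly_1 mat_poly_X A_def[symmetric])

text \<open>The Rota-Baxter identity at x = 1 and y = f(A): since T(1) = A, the argument of
  \<open>T\<close> and the product on the left are polynomials in \<open>A\<close>.\<close>

lemma represents_step:
  assumes "represents f s"
  shows "represents ([:0, 1:] * f + s + f) ([:0, 1:] * s)"
proof -
  note C = mat_poly_carrier[OF A_carrier]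
  have "T (1\<^sub>m n) * T (mat_poly f A)
      = T (T (1\<^sub>m n) * mat_poly f A + 1\<^sub>m n * T (mat_poly f A) + 1 \<cdot>\<^sub>m (1\<^sub>m n * mat_poly f A))"
    using rb C[of f] unfolding rota_baxter_mat_def by (metis one_carrier_mat)
  also have "T (1\<^sub>m n) * mat_poly f A + 1\<^sub>m n * T (mat_poly f A) + 1 \<cdot>\<^sub>m (1\<^sub>m n * mat_poly f A)
      = mat_poly ([:0, 1:] * f + s + f) A"
  proof -
    have "1 \<cdot>\<^sub>m (1\<^sub>m n * mat_poly f A) = mat_poly f A" using C[of f] by auto
    moreover have "1\<^sub>m n * T (mat_poly f A) = mat_poly s A"
      using assms C[of s] by (simp add: represents_def)
    moreover have "T (1\<^sub>m n) * mat_poly f A = mat_poly ([:0, 1:] * f) A"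
      by (simp only: mat_poly_mult[OF A_carrier] mat_poly_X[OF A_carrier] flip: A_def)
    ultimately show ?thesis by (simp only: mat_poly_add[OF A_carrier])
  qed
  also have "T (1\<^sub>m n) * T (mat_poly f A) = mat_poly ([:0, 1:] * s) A"
    using assms unfolding represents_def
    by (simp only: mat_poly_mult[OF A_carrier] mat_poly_X[OF A_carrier] flip: A_def)
  finally show ?thesis by (simp add: represents_def)
qed

lemma represents_ffact_poly:
  "represents (ffact_poly k) (Polynomial.smult (1 / of_nat (Suc k)) (ffact_poly (Suc k)))"
proof (induction k)
  case 0
  show ?case using represents_1 by (simp add: ffact_poly_def)
next
  case (Suc k)
  define c :: 'a where "c = 1 / of_nat (Suc k)"
  let ?F = "ffact_poly k :: 'a poly" and ?G = "ffact_poly (Suc k) :: 'a poly"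
    and ?H = "ffact_poly (Suc (Suc k)) :: 'a poly"
  have k0: "(of_nat k + 1 :: 'a) \<noteq> 0" "(of_nat k + 2 :: 'a) \<noteq> 0"
    using of_nat_neq_0[of k, where ?'a = 'a] of_nat_neq_0[of "Suc k", where ?'a = 'a]
    by (auto simp: add_ac)
  have "represents ([:0, 1:] * ?F + Polynomial.smult c ?G + ?F) ([:0, 1:] * Polynomial.smult c ?G)"
    using represents_step[OF Suc.IH] by (simp only: c_def)
  \<comment> \<open>Subtracting k + 1 times the induction hypothesis cancels the multiple of
    \<open>?F\<close> in the first argument and turns X \<open>?G\<close> into \<open>?H\<close> in
    the second.\<close>
  from represents_add[OF this represents_smult[OF Suc.IH, of "- of_nat (Suc k)"]]
  have "represents ([:0, 1:] * ?F + Polynomial.smult c ?G + ?F + Polynomial.smult (- of_nat (Suc k)) ?F)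
     ([:0, 1:] * Polynomial.smult c ?G + Polynomial.smult (- of_nat (Suc k)) (Polynomial.smult c ?G))"
    by (simp only: c_def)
  also have "[:0, 1:] * ?F + Polynomial.smult c ?G + ?F + Polynomial.smult (- of_nat (Suc k)) ?F
      = Polynomial.smult (1 + c) ?G"
    unfolding X_times_ffact_poly by (simp add: smult_add_left smult_diff_left)
  also have "[:0, 1:] * Polynomial.smult c ?G + Polynomial.smult (- of_nat (Suc k)) (Polynomial.smult c ?G)
      = Polynomial.smult c ?H"
    unfolding mult_smult_right X_times_ffact_poly
    by (simp add: smult_add_right smult_add_left smult_diff_left algebra_simps)
  finally have "represents (Polynomial.smult (1 + c) ?G) (Polynomial.smult c ?H)" .
  \<comment> \<open>In characteristic zero 1 + c = (k + 2) / (k + 1) is nonzero and can be divided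
    out; c / (1 + c) = 1 / (k + 2).\<close>
  from represents_smult[OF this, of "1 / (1 + c)"] show ?case
    using k0 by (simp add: c_def field_simps)
qed

text \<open>Expansion in falling factorials from the top coefficient down; the induction runs on a
  bound because the degree may drop by more than one. The degree of \<open>s\<close> will bound that
  of s / m, and the value at 0 will force 0 or -1 to be a root.\<close>

lemma represents_sum:
  assumes "degree f \<le> d"
  shows "\<exists>s. represents f s \<and> degree s \<le> Suc d \<and> poly s 0 = 0 \<and>
           (\<forall>x. poly s (x + 1) - poly s x = poly f x)"
  using assms
proof (induction d arbitrary: f)
  case 0
  then obtain c where c: "f = [:c:]" by (metis degree_eq_zeroE le_zero_eq)
  show ?case
    using represents_smult[OF represents_1, of c] by (intro exI[of _ "[:0, c:]"]) (auto simp: c algebra_simps)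
next
  case (Suc d)
  define c where "c = Polynomial.coeff f (Suc d)"
  define g where "g = f - Polynomial.smult c (ffact_poly (Suc d))"
  have "degree g \<le> d"
  proof (rule degree_le, intro allI impI)
    fix i assume "d < i"
    show "Polynomial.coeff g i = 0"
    proof (cases "i = Suc d")
      case True
      thus ?thesis by (simp add: g_def c_def lead_coeff_ffact_poly)
    next
      case False
      hence "degree f < i" "degree (ffact_poly (Suc d) :: 'a poly) < i" using \<open>d < i\<close> Suc.prems by auto
      thus ?thesis unfolding g_def by (simp add: coeff_eq_0)
    qed
  qed
  then obtain t where t: "represents g t" "degree t \<le> Suc d" "poly t 0 = 0"
    "\<And>x. poly t (x + 1) - poly t x = poly g x" using Suc.IH by blast
  define h where "h = Polynomial.smult (c / of_nat (Suc (Suc d))) (ffact_poly (Suc (Suc d)))"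
  have "represents (g + Polynomial.smult c (ffact_poly (Suc d))) (t + h)"
    using represents_add[OF t(1) represents_smult[OF represents_ffact_poly, of c "Suc d"]]
    by (simp add: h_def)
  moreover have "poly h (x + 1) - poly h x = c * poly (ffact_poly (Suc d)) x" for x
  proof -
    have "poly h (x + 1) - poly h x = c / of_nat (Suc (Suc d)) *
        (poly (ffact_poly (Suc (Suc d))) (x + 1) - poly (ffact_poly (Suc (Suc d))) x)"
      unfolding h_def poly_smult by (simp only: right_diff_distrib)
    also have "\<dots> = c * poly (ffact_poly (Suc d)) x"
      unfolding ffact_poly_difference by (simp del: of_nat_Suc)
    finally show ?thesis .
  qed
  moreover have "degree (t + h) \<le> Suc (Suc d)"
    using t(2) by (intro degree_add_le) (auto simp: h_def)
  moreover have "poly h 0 = 0" unfolding h_def poly_smult poly_ffact_poly_Suc_0 by simp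
  ultimately show ?case using t(3,4) by (intro exI[of _ "t + h"]) (auto simp: g_def algebra_simps)
qed

end

section \<open>Roots of a polynomial that divides its indefinite sum\<close>

text \<open>Here \<open>c\<close> is the top of the progression, c + 1 is the root of the linear
  cofactor s / m, and K + 1 is the number of roots.\<close>

lemma roots_of_sum_divisor:
  fixes m s :: "'a::{alg_closed_field, field_char_0} poly"
  assumes m: "m \<noteq> 0" "degree m > 0" and dvd: "m dvd s" and deg: "degree s \<le> Suc (degree m)"
    and s0: "poly s 0 = 0" and diff: "\<And>x. poly s (x + 1) - poly s x = poly m x"
  obtains c K where "{r. poly m r = 0} = {c - of_nat j | j. j \<le> K}"
    and "poly m 0 = 0 \<or> c = - 1"
    and "\<And>r. poly m r = 0 \<Longrightarrow> poly (pderiv m) r \<noteq> 0"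
proof -
  obtain g where g: "s = m * g" using dvd by (elim dvdE)
  have step: "poly m (x + 1) * poly g (x + 1) = poly m x * (1 + poly g x)" for x
    using diff[of x] by (simp add: g algebra_simps)
  have fin: "finite {r. poly m r = 0}" using m(1) by (simp add: poly_roots_finite)
  have inj: "inj (\<lambda>k. r + of_nat k :: 'a)" for r by (auto simp: inj_on_def)
  have "g \<noteq> 0"
  proof
    assume "g = 0"
    hence "poly m x = 0" for x using step[of x] by simp
    thus False using m(1) poly_all_0_iff_0 by blast
  qed
  hence "degree g \<le> 1" using deg m(1) unfolding g by (subst (asm) degree_mult_eq) auto
  hence "g = [:Polynomial.coeff g 0, Polynomial.coeff g 1:]"
    by (intro poly_eqI) (auto simp: coeff_pCons coeff_eq_0 split: nat.split)
  then obtain a b where ab: "g = [:b, a:]" by blast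
  \<comment> \<open>Walk up from \<open>r\<close> in steps of 1. There are finitely many roots, so
    the walk leaves them at some r + k + 1. The right-hand side of \<open>step\<close> at x = r + k
    vanishes but m(r + k + 1) does not, which makes r + k + 1 a root of \<open>g\<close>.\<close>
  have chain: "\<exists>k. poly g (r + of_nat k + 1) = 0 \<and> poly m (r + of_nat k + 1) \<noteq> 0 \<and>
      (\<forall>i\<le>k. poly m (r + of_nat i) = 0)" if r: "poly m r = 0" for r
  proof -
    have "\<exists>k. poly m (r + of_nat k) \<noteq> 0"
    proof (rule ccontr)
      assume "\<not> ?thesis"
      hence "range (\<lambda>k. r + of_nat k) \<subseteq> {r. poly m r = 0}" by auto
      thus False using fin inj[of r] finite_subset range_inj_infinite by blast
    qed
    then obtain k where k: "poly m (r + of_nat k) \<noteq> 0"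
      and less: "\<And>i. i < k \<Longrightarrow> poly m (r + of_nat i) = 0"
      using exists_least_iff[of "\<lambda>k. poly m (r + of_nat k) \<noteq> 0"] by auto
    have "k \<noteq> 0" using k r by (intro notI) simp
    then obtain l where l: "k = Suc l" using not0_implies_Suc by blast
    show ?thesis using less[of l] k step[of "r + of_nat l"] less
      by (intro exI[of _ l]) (auto simp: l add_ac)
  qed
  obtain r0 where r0: "poly m r0 = 0" using alg_closed_imp_poly_has_root[OF m(2)] by auto
  have "a \<noteq> 0" using chain[OF r0] \<open>g \<noteq> 0\<close> by (auto simp: ab)
  define c where "c = - b / a - 1"
  have groot: "poly g x = 0 \<longleftrightarrow> x = c + 1" for x
    using \<open>a \<noteq> 0\<close> by (auto simp: ab c_def field_simps add_eq_0_iff)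
  have mc: "poly m (c + 1) \<noteq> 0" using chain[OF r0] groot by auto
  \<comment> \<open>All chains leave the roots at the same point c + 1, so every root lies in the
    progression descending from \<open>c\<close>, with no gap above it.\<close>
  have down: "\<exists>k. r = c - of_nat k \<and> (\<forall>i\<le>k. poly m (c - of_nat i) = 0)" if r: "poly m r = 0" for r
  proof -
    obtain k where k: "r + of_nat k + 1 = c + 1" "\<forall>i\<le>k. poly m (r + of_nat i) = 0"
      using chain[OF r] groot by blast
    have "poly m (c - of_nat i) = 0" if "i \<le> k" for i
    proof -
      have "c - of_nat i = r + of_nat (k - i)" using k(1) that by (auto simp: of_nat_diff algebra_simps)
      thus ?thesis using k(2) by simp
    qed
    thus ?thesis using k(1) by (intro exI[of _ k]) (auto simp: algebra_simps)
  qed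
  \<comment> \<open>\<open>J\<close> records how far down from \<open>c\<close> the roots run
    without a gap; its maximum is \<open>K\<close>.\<close>
  define J where "J = {k. \<forall>i\<le>k. poly m (c - of_nat i) = 0}"
  have "finite J"
  proof (rule finite_imageD)
    show "finite ((\<lambda>k. c - of_nat k) ` J)"
      by (rule finite_subset[OF _ fin]) (auto simp: J_def)
  qed (auto simp: inj_on_def)
  moreover have "J \<noteq> {}" using down[OF r0] by (auto simp: J_def)
  ultimately obtain K where K: "K \<in> J" "\<And>k. k \<in> J \<Longrightarrow> k \<le> K"
    by (metis Max_in Max_ge)
  have roots: "{r. poly m r = 0} = {c - of_nat j | j. j \<le> K}"
  proof (intro equalityI subsetI)
    fix r assume "r \<in> {r. poly m r = 0}"
    then obtain k where "r = c - of_nat k" "k \<in> J" using down[of r] by (auto simp: J_def)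
    thus "r \<in> {c - of_nat j | j. j \<le> K}" using K(2) by blast
  next
    fix r assume "r \<in> {c - of_nat j | j. j \<le> K}"
    thus "r \<in> {r. poly m r = 0}" using K(1) by (auto simp: J_def)
  qed
  have simple: "poly (pderiv m) (c - of_nat j) \<noteq> 0" if "poly m (c - of_nat j) = 0" for j
    using that
  proof (induction j)
    \<comment> \<open>Agreement at all points is lifted to an equality of polynomials so that it can
      be differentiated.\<close>
    have "pderiv (pcompose (m * g) [:1, 1:]) = pderiv (m * (1 + g))"
    proof -
      have "poly (pcompose (m * g) [:1, 1:]) x = poly (m * (1 + g)) x" for x
        using step[of x] by (simp add: poly_pcompose add_ac)
      hence "poly (pcompose (m * g) [:1, 1:]) = poly (m * (1 + g))" by (rule ext)
      thus ?thesis by (simp only: poly_eq_poly_eq_iff)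
    qed
    hence eq: "poly (pderiv (pcompose (m * g) [:1, 1:])) x = poly (pderiv (m * (1 + g))) x" for x
      by simp
    have dstep: "poly (pderiv m) (x + 1) * poly g (x + 1) + a * poly m (x + 1)
        = poly (pderiv m) x * (1 + poly g x) + a * poly m x" for x
      using eq[of x]
      by (simp add: pderiv_smult add.commute[of x 1] pderiv_pcompose poly_pcompose pderiv_mult
        pderiv_add pderiv_pCons ab algebra_simps)
    {
      case 0
      \<comment> \<open>Since g(c + 1) = m(c) = 0, \<open>dstep\<close> at \<open>c\<close> reads a
        m(c + 1) = m'(c) (1 + g(c)), with nonzero left side.\<close>
      show ?case using dstep[of c] groot[of "c + 1"] mc \<open>a \<noteq> 0\<close> 0 by auto
    next
      case (Suc j)
      have "poly m (c - of_nat j) = 0"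
      proof -
        obtain k where k: "c - of_nat (Suc j) = c - of_nat k" "\<forall>i\<le>k. poly m (c - of_nat i) = 0"
          using down[OF Suc.prems] by blast
        hence "k = Suc j" by (simp del: of_nat_Suc)
        thus ?thesis using k(2) by simp
      qed
      moreover have "poly g (c - of_nat j) \<noteq> 0"
      proof
        assume "poly g (c - of_nat j) = 0"
        hence "of_nat (Suc j) = (0 :: 'a)" using groot by (simp add: algebra_simps)
        thus False using of_nat_neq_0 by blast
      qed
      \<comment> \<open>For x = c - (j + 1) both m(x) and m(x + 1) vanish, so m'(x + 1) g(x + 1) =
        m'(x) (1 + g(x)), again with nonzero left side.\<close>
      ultimately show ?case using dstep[of "c - of_nat (Suc j)"] Suc by auto
    }
  qed
  have "poly m 0 = 0 \<or> c = - 1"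
  proof -
    have "poly m 0 = 0 \<or> poly g 0 = 0" using s0 by (simp add: g)
    thus ?thesis using groot[of 0] by (auto simp: eq_neg_iff_add_eq_0)
  qed
  moreover have "poly (pderiv m) r \<noteq> 0" if "poly m r = 0" for r
    using down[OF that] simple that by auto
  ultimately show ?thesis using that roots by blast
qed

section \<open>Conjugation and rescaling\<close>

lemma mat_alg_aut_conjugation:
  fixes P Q :: "'a::field mat"
  assumes P: "P \<in> carrier_mat n n" and Q: "Q \<in> carrier_mat n n"
    and PQ: "P * Q = 1\<^sub>m n" and QP: "Q * P = 1\<^sub>m n"
  defines "\<psi> \<equiv> \<lambda>X. P * X * Q"
  shows "mat_alg_aut n \<psi>"
    and "X \<in> carrier_mat n n \<Longrightarrow> the_inv_into (carrier_mat n n) \<psi> (P * X * Q) = X"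
proof -
  have inv: "Q * (P * X * Q) * P = X" "P * (Q * X * P) * Q = X" if X: "X \<in> carrier_mat n n" for X
  proof -
    have "Q * (P * X * Q) * P = (Q * P) * X * (Q * P)"
      using P Q X by (simp add: assoc_mult_mat[of _ n n _ n _ n])
    thus "Q * (P * X * Q) * P = X" using X by (simp add: QP)
    have "P * (Q * X * P) * Q = (P * Q) * X * (P * Q)"
      using P Q X by (simp add: assoc_mult_mat[of _ n n _ n _ n])
    thus "P * (Q * X * P) * Q = X" using X by (simp add: PQ)
  qed
  have bij: "bij_betw \<psi> (carrier_mat n n) (carrier_mat n n)"
  proof (rule bij_betw_byWitness[of _ "\<lambda>X. Q * X * P"])
    show "\<forall>X \<in> carrier_mat n n. Q * \<psi> X * P = X" "\<forall>X \<in> carrier_mat n n. \<psi> (Q * X * P) = X"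
      using inv by (simp_all add: \<psi>_def)
    show "\<psi> ` carrier_mat n n \<subseteq> carrier_mat n n" "(\<lambda>X. Q * X * P) ` carrier_mat n n \<subseteq> carrier_mat n n"
      unfolding \<psi>_def by (intro image_subsetI mult_carrier_mat[of _ n n] P Q; assumption)+
  qed
  thus "X \<in> carrier_mat n n \<Longrightarrow> the_inv_into (carrier_mat n n) \<psi> (P * X * Q) = X"
    using the_inv_into_f_f[of \<psi> "carrier_mat n n" X] by (auto simp: bij_betw_def \<psi>_def)
  have add: "\<psi> (X + Y) = \<psi> X + \<psi> Y" if "X \<in> carrier_mat n n" "Y \<in> carrier_mat n n" for X Y
    using that P Q
    by (simp add: \<psi>_def mult_add_distrib_mat[of P n n] add_mult_distrib_mat[of _ n n _ Q n])
  have mult: "\<psi> (X * Y) = \<psi> X * \<psi> Y" if X: "X \<in> carrier_mat n n" and Y: "Y \<in> carrier_mat n n" for X Y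
  proof -
    have "\<psi> X * \<psi> Y = P * X * (Q * P) * (Y * Q)"
      using P Q X Y by (simp add: \<psi>_def assoc_mult_mat[of _ n n _ n _ n])
    also have "\<dots> = \<psi> (X * Y)"
      using P Q X Y by (simp add: \<psi>_def QP assoc_mult_mat[of _ n n _ n _ n])
    finally show ?thesis ..
  qed
  have smult: "\<psi> (c \<cdot>\<^sub>m X) = c \<cdot>\<^sub>m \<psi> X" if X: "X \<in> carrier_mat n n" for c X
    using P Q X by (simp add: \<psi>_def mult_smult_distrib[of P n n] mult_smult_assoc_mat[of _ n n])
  have "\<psi> (1\<^sub>m n) = 1\<^sub>m n" using P by (simp add: \<psi>_def PQ)
  thus "mat_alg_aut n \<psi>" using bij add mult smult by (simp add: mat_alg_aut_def)
qed

text \<open>The left side of the identity is quadratic in \<open>R\<close>. Of the two factors 1 /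
  lam, one stays outside \<open>R\<close> on the right and the other moves inside, where it turns
  lam x y into x y.\<close>

lemma rota_baxter_mat_normalize:
  fixes R :: "'a::field mat \<Rightarrow> 'a mat"
  assumes "lam \<noteq> 0" and rb: "rota_baxter_mat n lam R"
  shows "rota_baxter_mat n 1 (\<lambda>X. (1 / lam) \<cdot>\<^sub>m R X)"
proof -
  let ?c = "1 / lam"
  have carr: "R X \<in> carrier_mat n n" if "X \<in> carrier_mat n n" for X
    using rb that by (simp add: rota_baxter_mat_def lin_op_mat_def)
  have add: "R (X + Y) = R X + R Y" if "X \<in> carrier_mat n n" "Y \<in> carrier_mat n n" for X Y
    using rb that by (simp add: rota_baxter_mat_def lin_op_mat_def)
  have smult: "R (c \<cdot>\<^sub>m X) = c \<cdot>\<^sub>m R X" if "X \<in> carrier_mat n n" for c X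
    using rb that by (simp add: rota_baxter_mat_def lin_op_mat_def)
  have "(?c \<cdot>\<^sub>m R x) * (?c \<cdot>\<^sub>m R y)
      = ?c \<cdot>\<^sub>m R ((?c \<cdot>\<^sub>m R x) * y + x * (?c \<cdot>\<^sub>m R y) + 1 \<cdot>\<^sub>m (x * y))"
    if x: "x \<in> carrier_mat n n" and y: "y \<in> carrier_mat n n" for x y
  proof -
    note Rx = carr[OF x] and Ry = carr[OF y]
    have "(?c \<cdot>\<^sub>m R x) * (?c \<cdot>\<^sub>m R y) = ?c \<cdot>\<^sub>m (?c \<cdot>\<^sub>m (R x * R y))"
      using Rx Ry by (simp add: mult_smult_assoc_mat[of _ n n _ n] mult_smult_distrib[of _ n n _ n])
    also have "R x * R y = R (R x * y + x * R y + lam \<cdot>\<^sub>m (x * y))"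
      using rb x y by (simp add: rota_baxter_mat_def)
    also have "?c \<cdot>\<^sub>m R (R x * y + x * R y + lam \<cdot>\<^sub>m (x * y))
        = R (?c \<cdot>\<^sub>m (R x * y + x * R y + lam \<cdot>\<^sub>m (x * y)))"
      using x y Rx Ry by (intro smult[symmetric]) auto
    also have "?c \<cdot>\<^sub>m (R x * y + x * R y + lam \<cdot>\<^sub>m (x * y))
        = ?c \<cdot>\<^sub>m (R x * y) + ?c \<cdot>\<^sub>m (x * R y) + 1 \<cdot>\<^sub>m (x * y)"
      using x y Rx Ry \<open>lam \<noteq> 0\<close>
      by (intro eq_matI) (auto simp: field_simps simp del: index_mult_mat(1))
    also have "?c \<cdot>\<^sub>m (R x * y) = (?c \<cdot>\<^sub>m R x) * y"
      using Rx y by (simp add: mult_smult_assoc_mat)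
    also have "?c \<cdot>\<^sub>m (x * R y) = x * (?c \<cdot>\<^sub>m R y)"
      using Ry x by (simp add: mult_smult_distrib)
    finally show ?thesis .
  qed
  moreover have "?c \<cdot>\<^sub>m (R A + R B) = ?c \<cdot>\<^sub>m R A + ?c \<cdot>\<^sub>m R B"
    if "A \<in> carrier_mat n n" "B \<in> carrier_mat n n" for A B
    using carr[OF that(1)] carr[OF that(2)] \<open>lam \<noteq> 0\<close> by (intro eq_matI) (auto simp: field_simps)
  moreover have "?c \<cdot>\<^sub>m (d \<cdot>\<^sub>m R A) = d \<cdot>\<^sub>m (?c \<cdot>\<^sub>m R A)" if "A \<in> carrier_mat n n" for d A
    using carr[OF that] by (intro eq_matI) (auto simp: field_simps)
  ultimately show ?thesis
    unfolding rota_baxter_mat_def lin_op_mat_def using carr add smult by simp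
qed

section \<open>The spectrum of R(1)\<close>

lemma unit_weight_spectrum:
  fixes T :: "'a::{alg_closed_field, field_char_0} mat \<Rightarrow> 'a mat"
  assumes "n > 0" and rb: "rota_baxter_mat n 1 T"
  obtains P Q D c K where "similar_mat_wit (T (1\<^sub>m n)) D P Q" "diagonal_mat D"
    "diag_entries n D = {c - of_nat j | j. j \<le> K}" "0 \<in> diag_entries n D \<or> c = - 1"
proof -
  define A where "A = T (1\<^sub>m n)"
  interpret unit_weight_rota_baxter n T A
    using rb by unfold_locales (auto simp: A_def)
  note A = A_carrier
  obtain m where m: "m \<noteq> 0" "\<And>p. mat_poly p A = 0\<^sub>m n n \<longleftrightarrow> m dvd p"
    using minimal_poly_exists[OF A] by blast
  \<comment> \<open>For n = 0 the identity matrix is zero and \<open>m\<close> would be constant; a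
    positive size excludes this.\<close>
  have "degree m > 0"
  proof (rule ccontr)
    assume "\<not> degree m > 0"
    hence "m dvd 1" using m(1) by (simp add: is_unit_iff_degree)
    hence "1\<^sub>m n = (0\<^sub>m n n :: 'a mat)" using m(2)[of 1] mat_poly_1[OF A] by simp
    hence "1\<^sub>m n $$ (0, 0) = (0\<^sub>m n n :: 'a mat) $$ (0, 0)" by simp
    thus False using \<open>n > 0\<close> by simp
  qed
  obtain s where s: "represents m s" "degree s \<le> Suc (degree m)" "poly s 0 = 0"
    "\<And>x. poly s (x + 1) - poly s x = poly m x"
    using represents_sum[OF order.refl, of m] by blast
  have "T (0\<^sub>m n n) = 0\<^sub>m n n"
  proof -
    have "T (0\<^sub>m n n) = 0 \<cdot>\<^sub>m T (0\<^sub>m n n)" using T_smult[of "0\<^sub>m n n" 0] by simp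
    also have "\<dots> = 0\<^sub>m n n" using T_carrier[of "0\<^sub>m n n"] by (intro eq_matI) auto
    finally show ?thesis .
  qed
  \<comment> \<open>T(m(A)) = T(0) = 0 gives s(A) = 0, so the minimal polynomial divides its own
    indefinite sum.\<close>
  hence dvd: "m dvd s" using s(1) m(2)[of m] m(2)[of s] by (simp add: represents_def)
  obtain c K where c: "{r. poly m r = 0} = {c - of_nat j | j. j \<le> K}"
      "poly m 0 = 0 \<or> c = - 1" "\<And>r. poly m r = 0 \<Longrightarrow> poly (pderiv m) r \<noteq> 0"
    using roots_of_sum_divisor[OF m(1) \<open>degree m > 0\<close> dvd s(2-4)] by blast
  have mA: "mat_poly m A = 0\<^sub>m n n" by (simp add: m(2))
  obtain P Q D where D: "similar_mat_wit A D P Q" "diagonal_mat D"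
    by (rule diagonalizable_if_simple_roots[OF A m(1) mA c(3)])
  have entries: "diag_entries n D = {r. poly m r = 0}" by (rule diag_entries_eq_roots[OF A D m])
  show ?thesis
  proof (rule that)
    show "similar_mat_wit (T (1\<^sub>m n)) D P Q" using D(1) by (simp only: A_def)
    show "diagonal_mat D" by (rule D(2))
    show "diag_entries n D = {c - of_nat j | j. j \<le> K}" by (simp only: entries c(1))
    show "0 \<in> diag_entries n D \<or> c = - 1" using c(2) by (simp only: entries mem_Collect_eq)
  qed
qed

theorem theorem11:
  fixes R :: "'a::{alg_closed_field, field_char_0} mat \<Rightarrow> 'a mat"
    and lam :: 'a and n :: nat
  assumes "n > 0"
    and "lam \<noteq> 0"
    and "rota_baxter_mat n lam R"
  shows "\<exists>\<psi>. mat_alg_aut n \<psi> \<and>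
           diagonal_mat (rb_conj n \<psi> R (1\<^sub>m n)) \<and>
           (\<exists>R' \<in> {R, rb_phi lam R}. \<exists>p q :: nat.
              diag_entries n (rb_conj n \<psi> R' (1\<^sub>m n)) =
                {of_int k * lam | k. - int p \<le> k \<and> k \<le> int q})"
proof -
  define A where "A = (1 / lam) \<cdot>\<^sub>m R (1\<^sub>m n)"
  have R1: "R (1\<^sub>m n) \<in> carrier_mat n n"
    using assms(3) by (simp add: rota_baxter_mat_def lin_op_mat_def)
  hence A: "A \<in> carrier_mat n n" by (simp add: A_def)
  obtain P Q D c K where D: "similar_mat_wit A D P Q" "diagonal_mat D"
      and c: "diag_entries n D = {c - of_nat j | j. j \<le> K}" "0 \<in> diag_entries n D \<or> c = - 1"
    unfolding A_def by (rule unit_weight_spectrum[OF assms(1) rota_baxter_mat_normalize[OF assms(2,3)]])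
  have DC: "D \<in> carrier_mat n n" and P: "P \<in> carrier_mat n n" and Q: "Q \<in> carrier_mat n n"
    and PQ: "P * Q = 1\<^sub>m n" and QP: "Q * P = 1\<^sub>m n" and APDQ: "A = P * D * Q"
    using similar_mat_witD2[OF A D(1)] by auto
  define \<psi> where "\<psi> = (\<lambda>X. P * X * Q)"
  have aut: "mat_alg_aut n \<psi>"
    and inv: "\<And>X. X \<in> carrier_mat n n \<Longrightarrow> the_inv_into (carrier_mat n n) \<psi> (P * X * Q) = X"
    using mat_alg_aut_conjugation[OF P Q PQ QP] by (simp_all add: \<psi>_def)
  have \<psi>1: "\<psi> (1\<^sub>m n) = 1\<^sub>m n" using aut by (simp add: mat_alg_aut_def)
  have "R (1\<^sub>m n) = lam \<cdot>\<^sub>m A" using R1 assms(2) by (intro eq_matI) (auto simp: A_def)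
  also have "\<dots> = \<psi> (lam \<cdot>\<^sub>m D)"
    using aut DC by (simp add: mat_alg_aut_def APDQ \<psi>_def)
  finally have R1_eq: "R (1\<^sub>m n) = \<psi> (lam \<cdot>\<^sub>m D)" .
  have conj: "rb_conj n \<psi> R (1\<^sub>m n) = lam \<cdot>\<^sub>m D"
    using inv[of "lam \<cdot>\<^sub>m D"] DC by (simp add: rb_conj_def \<psi>1 R1_eq) (simp add: \<psi>_def)
  \<comment> \<open>As \<psi> fixes the identity, the same \<psi> also diagonalizes phi(R)(1), and
    an entry x of \<open>D\<close> contributes -(x + 1) lam to it.\<close>
  have "- R (1\<^sub>m n) - lam \<cdot>\<^sub>m 1\<^sub>m n = (- lam) \<cdot>\<^sub>m \<psi> (D + 1\<^sub>m n)"
  proof -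
    have "\<psi> (D + 1\<^sub>m n) = \<psi> D + 1\<^sub>m n" "\<psi> (lam \<cdot>\<^sub>m D) = lam \<cdot>\<^sub>m \<psi> D"
      using aut DC \<psi>1 by (simp_all add: mat_alg_aut_def)
    thus ?thesis unfolding R1_eq using P Q DC
      by (intro eq_matI) (auto simp: \<psi>_def algebra_simps simp del: index_mult_mat(1))
  qed
  also have "\<dots> = \<psi> ((- lam) \<cdot>\<^sub>m (D + 1\<^sub>m n))" using aut DC by (simp add: mat_alg_aut_def)
  finally have conj_phi: "rb_conj n \<psi> (rb_phi lam R) (1\<^sub>m n) = (- lam) \<cdot>\<^sub>m (D + 1\<^sub>m n)"
    using inv[of "(- lam) \<cdot>\<^sub>m (D + 1\<^sub>m n)"] DC
    by (simp add: rb_conj_def rb_phi_def \<psi>1) (simp add: \<psi>_def)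
  have diag: "diagonal_mat (rb_conj n \<psi> R (1\<^sub>m n))"
    using D(2) DC by (auto simp: conj diagonal_mat_def)
  have entries: "diag_entries n M = (\<lambda>i. M $$ (i, i)) ` {..<n}" for M :: "'a mat"
    by (auto simp: diag_entries_def)
  have "\<exists>R' \<in> {R, rb_phi lam R}. \<exists>p q :: nat.
      diag_entries n (rb_conj n \<psi> R' (1\<^sub>m n)) = {of_int k * lam | k. - int p \<le> k \<and> k \<le> int q}"
    using c(2)
  proof
    assume "0 \<in> diag_entries n D"
    \<comment> \<open>The spectrum of \<open>D\<close> is {j - K, ..., j}, so p = K - j and q =
      j.\<close>
    then obtain j where j: "c = of_nat j" "j \<le> K" unfolding c(1) by auto
    have "diag_entries n (lam \<cdot>\<^sub>m D) = (\<lambda>x. x * lam) ` diag_entries n D"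
      unfolding entries image_image using DC by (intro image_cong) (auto simp: algebra_simps)
    also have "\<dots> = {of_int k * lam | k. - int (K - j) \<le> k \<and> k \<le> int j}"
    proof (intro equalityI subsetI)
      fix x assume "x \<in> (\<lambda>x. x * lam) ` diag_entries n D"
      then obtain i where "i \<le> K" "x = (of_nat j - of_nat i) * lam" by (auto simp: c(1) j(1))
      thus "x \<in> {of_int k * lam | k. - int (K - j) \<le> k \<and> k \<le> int j}"
        using j(2) by (intro CollectI exI[of _ "int j - int i"]) auto
    next
      fix x assume "x \<in> {of_int k * lam | k. - int (K - j) \<le> k \<and> k \<le> int j}"
      then obtain k where k: "x = of_int k * lam" "- int (K - j) \<le> k" "k \<le> int j" by auto
      have "of_int k = c - of_nat (nat (int j - k))" using k(3) by (simp add: j(1))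
      moreover have "nat (int j - k) \<le> K" using k(2) j(2) by auto
      ultimately show "x \<in> (\<lambda>x. x * lam) ` diag_entries n D" unfolding k(1) c(1) by blast
    qed
    finally show ?thesis unfolding conj[symmetric] by blast
  next
    assume c1: "c = - 1"
    \<comment> \<open>Here the spectrum of \<open>D\<close> is {-1 - K, ..., -1}, which x -> -(x +
      1) maps onto {0, ..., K}; so phi(R) serves with p = 0 and q = K.\<close>
    have "diag_entries n ((- lam) \<cdot>\<^sub>m (D + 1\<^sub>m n)) = (\<lambda>x. - (x + 1) * lam) ` diag_entries n D"
      unfolding entries image_image using DC by (intro image_cong) (auto simp: algebra_simps)
    also have "\<dots> = {of_int k * lam | k. - int 0 \<le> k \<and> k \<le> int K}"
    proof (intro equalityI subsetI)
      fix x assume "x \<in> (\<lambda>x. - (x + 1) * lam) ` diag_entries n D"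
      then obtain i where "i \<le> K" "x = of_nat i * lam" by (auto simp: c(1) c1)
      thus "x \<in> {of_int k * lam | k. - int 0 \<le> k \<and> k \<le> int K}"
        by (intro CollectI exI[of _ "int i"]) auto
    next
      fix x assume "x \<in> {of_int k * lam | k. - int 0 \<le> k \<and> k \<le> int K}"
      then obtain k where k: "x = of_int k * lam" "0 \<le> k" "k \<le> int K" by auto
      have "of_int k = - ((c - of_nat (nat k)) + 1)" "nat k \<le> K" using k by (auto simp: c1)
      thus "x \<in> (\<lambda>x. - (x + 1) * lam) ` diag_entries n D"
        unfolding k(1) c(1) by (intro image_eqI[of _ _ "c - of_nat (nat k)"]) auto
    qed
    finally show ?thesis unfolding conj_phi[symmetric] by blast
  qed
  thus ?thesis using aut diag by blast
qed

end
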